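(* Let $X$ be a chain and let $\alpha\in\mathcal{OP}(X)$. Then $\alpha$ is a regular element of the monoid $\mathcal{OP}(X)$ if and only if the following two conditions are satisfied: (1) if $\mathrm{Im}(\alpha)$ has an upper bound or a lower bound in $X$, then $\max\mathrm{Im}(\alpha)$ exists or $\min\mathrm{Im}(\alpha)$ exists; (2) if $x\in X\setminus\mathrm{Im}(\alpha)$ is neither an upper bound nor a lower bound of $\mathrm{Im}(\alpha)$, then at least one of $\max\{t\in\mathrm{Im}(\alpha)\mid t<x\}$ and $\min\{t\in\mathrm{Im}(\alpha)\mid t>x\}$ exists.
   Context: $X$ is a chain (totally ordered set), finite or infinite. Maps are written on the right and composed from left to right: $x(\alpha\beta)=(x\alpha)\beta$. $\mathrm{Im}(\alpha)$ is the image of $\alpha$. A full transformation $\alpha:X\to X$ is called orientation-preserving if it is the empty transformation (only when $X=\emptyset$) or there exists a non-empty subset $Y$ of $X$ such that: (OP1) $\alpha$ is order-preserving (i.e. $x\le y$ implies $x\alpha\le y\alpha$) both on $Y$ and on $X\setminus Y$; (OP2) for all $a\in Y$ and $b\in X\setminus Y$, $a\le b$ and $a\alpha\ge b\alpha$. $\mathcal{OP}(X)$ is the monoid, under composition, of all orientation-preserving full transformations of $X$. An element $\alpha$ of a semigroup $S$ is regular in $S$ if $\alpha=\alpha\beta\alpha$ for some $\beta\in S$. *)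

theory Defs
  imports "HOL-Algebra.Group"
begin

text \<open>A chain is a set \<open>X\<close> of elements of a linearly ordered type, so that the empty
  chain is covered. Transformations of \<open>X\<close> are the extensional functions in
  \<open>X \<rightarrow>\<^sub>E X\<close>; equality of functions is then equality of transformations, and
  \<open>\<alpha> ` X\<close> is the image of \<open>\<alpha>\<close>.\<close>

definition orientation_preserving :: "'a::linorder set \<Rightarrow> ('a \<Rightarrow> 'a) \<Rightarrow> bool" where
  "orientation_preserving X \<alpha> \<longleftrightarrow>
     \<alpha> \<in> X \<rightarrow>\<^sub>E X \<and>
     (X = {} \<or>
      (\<exists>Y. Y \<noteq> {} \<and> Y \<subseteq> X \<and>
           mono_on Y \<alpha> \<and> mono_on (X - Y) \<alpha> \<and>
           (\<forall>a\<in>Y. \<forall>b\<in>X - Y. a \<le> b \<and> \<alpha> a \<ge> \<alpha> b)))"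

text \<open>Maps are written on the right, so the product \<open>\<alpha>\<beta>\<close> applies \<open>\<alpha>\<close> first, whereas
  \<^const>\<open>compose\<close> applies its last argument first.\<close>

definition OP :: "'a::linorder set \<Rightarrow> ('a \<Rightarrow> 'a) monoid" where
  "OP X = \<lparr>carrier = {\<alpha>. orientation_preserving X \<alpha>},
           mult = (\<lambda>\<alpha> \<beta>. compose X \<beta> \<alpha>),
           one = (\<lambda>x\<in>X. x)\<rparr>"

definition regular_element :: "('a, 'b) monoid_scheme \<Rightarrow> 'a \<Rightarrow> bool" where
  "regular_element S a \<longleftrightarrow>
     a \<in> carrier S \<and> (\<exists>b\<in>carrier S. a = a \<otimes>\<^bsub>S\<^esub> b \<otimes>\<^bsub>S\<^esub> a)"

definition has_max :: "'a::linorder set \<Rightarrow> bool" where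
  "has_max A \<longleftrightarrow> (\<exists>m\<in>A. \<forall>t\<in>A. t \<le> m)"

definition has_min :: "'a::linorder set \<Rightarrow> bool" where
  "has_min A \<longleftrightarrow> (\<exists>m\<in>A. \<forall>t\<in>A. m \<le> t)"

definition upper_bound :: "'a::linorder set \<Rightarrow> 'a \<Rightarrow> bool" where
  "upper_bound A u \<longleftrightarrow> (\<forall>t\<in>A. t \<le> u)"

definition lower_bound :: "'a::linorder set \<Rightarrow> 'a \<Rightarrow> bool" where
  "lower_bound A l \<longleftrightarrow> (\<forall>t\<in>A. l \<le> t)"

lemma orientation_preserving_id: "orientation_preserving X (\<lambda>x\<in>X. x)"
  unfolding orientation_preserving_def
  by (cases "X = {}") (auto intro!: exI[of _ X] simp: monotone_on_def)

lemma orientation_preserving_compose: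
  assumes "orientation_preserving X \<alpha>" and "orientation_preserving X \<beta>"
  shows "orientation_preserving X (compose X \<beta> \<alpha>)"
proof (cases "X = {}")
  case True
  then show ?thesis by (auto simp: orientation_preserving_def compose_def)
next
  case False
  have fa: "\<And>x. x \<in> X \<Longrightarrow> \<alpha> x \<in> X" and fb: "\<And>x. x \<in> X \<Longrightarrow> \<beta> x \<in> X"
    using assms by (auto simp: orientation_preserving_def)
  obtain Y where Y: "Y \<noteq> {}" "Y \<subseteq> X" "mono_on Y \<alpha>" "mono_on (X - Y) \<alpha>"
    "\<And>a b. a \<in> Y \<Longrightarrow> b \<in> X - Y \<Longrightarrow> a \<le> b \<and> \<alpha> a \<ge> \<alpha> b"
    using assms(1) False unfolding orientation_preserving_def by blast
  obtain Z where Z: "Z \<noteq> {}" "Z \<subseteq> X" "mono_on Z \<beta>" "mono_on (X - Z) \<beta>"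
    "\<And>a b. a \<in> Z \<Longrightarrow> b \<in> X - Z \<Longrightarrow> a \<le> b \<and> \<beta> a \<ge> \<beta> b"
    using assms(2) False unfolding orientation_preserving_def by blast
  have Yx: "a \<in> Y \<or> b \<notin> Y" if "a \<le> b" "a \<in> X" for a b
    using Y(5)[of b a] that by force
  have Zx: "a \<in> Z \<or> b \<notin> Z" if "a \<le> b" "a \<in> X" for a b
    using Z(5)[of b a] that by force
  have aY: "\<alpha> a \<le> \<alpha> b" if "a \<le> b" "a \<in> Y" "b \<in> Y" for a b
    using Y(3) that by (auto simp: monotone_on_def)
  have aN: "\<alpha> a \<le> \<alpha> b" if "a \<le> b" "a \<in> X" "a \<notin> Y" "b \<in> X" "b \<notin> Y" for a b
    using Y(4) that by (auto simp: monotone_on_def)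
  have bZ: "\<beta> a \<le> \<beta> b" if "a \<le> b" "a \<in> Z" "b \<in> Z" for a b
    using Z(3) that by (auto simp: monotone_on_def)
  have bN: "\<beta> a \<le> \<beta> b" if "a \<le> b" "a \<in> X" "a \<notin> Z" "b \<in> X" "b \<notin> Z" for a b
    using Z(4) that by (auto simp: monotone_on_def)
  define P where "P = {x \<in> X. \<alpha> x \<in> Z}"
  define W where "W = (if Y \<inter> P \<noteq> {} then Y \<inter> P else Y \<union> P)"
  have W: "W \<noteq> {}" "W \<subseteq> X"
    using Y(1,2) by (auto simp: W_def P_def)
  have c: "compose X \<beta> \<alpha> x = \<beta> (\<alpha> x)" if "x \<in> X" for x
    using that by (simp add: compose_def)
  have YX: "a \<in> X" if "a \<in> Y" for a using Y(2) that by auto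
  have aD: "\<alpha> b \<le> \<alpha> a" "a \<le> b" if "a \<in> Y" "b \<in> X" "b \<notin> Y" for a b
    using Y(5) that by auto
  have bD: "\<beta> b \<le> \<beta> a" "a \<le> b" if "a \<in> Z" "b \<in> X" "b \<notin> Z" for a b
    using Z(5) that by auto
  have W_iff: "x \<in> W \<longleftrightarrow> (if Y \<inter> P \<noteq> {} then x \<in> Y \<and> \<alpha> x \<in> Z else x \<in> Y \<or> \<alpha> x \<in> Z)"
    if "x \<in> X" for x
    using that by (auto simp: W_def P_def)
  have inZ: "\<alpha> b \<in> Z" if b: "Y \<inter> P \<noteq> {}" "b \<in> X" "b \<notin> Y" for b
  proof -
    obtain y where "y \<in> Y" "\<alpha> y \<in> Z" using b(1) by (auto simp: P_def)
    then show ?thesis using Zx[of "\<alpha> b" "\<alpha> y"] aD(1)[of y b] fa b by auto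
  qed
  have outZ: "\<alpha> a \<notin> Z" if "Y \<inter> P = {}" "a \<in> Y" for a
    using that YX by (auto simp: P_def)
  have m1: "\<beta> (\<alpha> a) \<le> \<beta> (\<alpha> b)" if "a \<in> W" "b \<in> W" "a \<le> b" for a b
  proof -
    have X: "a \<in> X" "b \<in> X" using that W(2) by auto
    note f = fa[OF X(1)] fa[OF X(2)]
    show ?thesis
    proof (cases "Y \<inter> P = {}")
      case True
      consider "a \<in> Y" "b \<in> Y" | "a \<in> Y" "b \<notin> Y" | "a \<notin> Y" "b \<in> Y" | "a \<notin> Y" "b \<notin> Y" by blast
      then show ?thesis
        using that True X f W_iff outZ[OF True] Yx[of a b] aN[of a b] aY[of a b] bN bZ bD(1)
        by cases auto
    next
      case False
      then show ?thesis using that X W_iff aY bZ by auto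
    qed
  qed
  have m2: "\<beta> (\<alpha> a) \<le> \<beta> (\<alpha> b)" if "a \<in> X - W" "b \<in> X - W" "a \<le> b" for a b
  proof -
    have X: "a \<in> X" "b \<in> X" using that by auto
    note f = fa[OF X(1)] fa[OF X(2)]
    show ?thesis
    proof (cases "Y \<inter> P = {}")
      case True
      then show ?thesis using that X f W_iff aN bN by auto
    next
      case False
      consider "a \<in> Y" "b \<in> Y" | "a \<in> Y" "b \<notin> Y" | "a \<notin> Y" "b \<in> Y" | "a \<notin> Y" "b \<notin> Y" by blast
      then show ?thesis
        using that False X f W_iff inZ[OF False] Yx[of a b] aN[of a b] aY[of a b] bN bZ bD(1)
        by cases auto
    qed
  qed
  have m3: "a \<le> b \<and> \<beta> (\<alpha> b) \<le> \<beta> (\<alpha> a)" if "a \<in> W" "b \<in> X - W" for a b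
  proof -
    have X: "a \<in> X" "b \<in> X" using that W(2) by auto
    note f = fa[OF X(1)] fa[OF X(2)]
    have ab: "a \<le> b \<or> b \<le> a" by auto
    consider "a \<in> Y" "b \<in> Y" | "a \<in> Y" "b \<notin> Y" | "a \<notin> Y" "b \<in> Y" | "a \<notin> Y" "b \<notin> Y" by blast
    then show ?thesis
    proof cases
      case 1
      then show ?thesis using that X f W_iff aY[of b a] Zx[of "\<alpha> b" "\<alpha> a"] bD(1)[of "\<alpha> a" "\<alpha> b"] ab
        by (auto split: if_splits)
    next
      case 2
      then show ?thesis
        using that X f W_iff aD[of a b] bZ[of "\<alpha> b" "\<alpha> a"] bN[of "\<alpha> b" "\<alpha> a"] inZ outZ
        by (auto split: if_splits)
    next
      case 3
      then show ?thesis using that X f W_iff by (auto split: if_splits)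
    next
      case 4
      then show ?thesis using that X f W_iff aN[of b a] Zx[of "\<alpha> b" "\<alpha> a"] bD(1)[of "\<alpha> a" "\<alpha> b"] ab
        by (auto split: if_splits)
    qed
  qed
  have "compose X \<beta> \<alpha> \<in> X \<rightarrow>\<^sub>E X"
    using fa fb by (auto simp: compose_def)
  moreover have "mono_on W (compose X \<beta> \<alpha>)" "mono_on (X - W) (compose X \<beta> \<alpha>)"
    using m1 m2 W(2) c by (auto simp: monotone_on_def subset_iff)
  moreover have "\<forall>a\<in>W. \<forall>b\<in>X - W. a \<le> b \<and> compose X \<beta> \<alpha> a \<ge> compose X \<beta> \<alpha> b"
    using m3 W(2) c by (auto simp: subset_iff)
  ultimately show ?thesis
    unfolding orientation_preserving_def using W by blast
qed

lemma monoid_OP: "monoid (OP X)"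
proof (rule monoidI)
  fix x y z assume "x \<in> carrier (OP X)" "y \<in> carrier (OP X)" "z \<in> carrier (OP X)"
  then have "x \<in> X \<rightarrow>\<^sub>E X" by (simp add: OP_def orientation_preserving_def)
  then show "x \<otimes>\<^bsub>OP X\<^esub> y \<otimes>\<^bsub>OP X\<^esub> z = x \<otimes>\<^bsub>OP X\<^esub> (y \<otimes>\<^bsub>OP X\<^esub> z)"
    by (auto simp: OP_def compose_def fun_eq_iff)
next
  fix x assume "x \<in> carrier (OP X)"
  then have x: "x \<in> X \<rightarrow>\<^sub>E X" by (simp add: OP_def orientation_preserving_def)
  show "\<one>\<^bsub>OP X\<^esub> \<otimes>\<^bsub>OP X\<^esub> x = x" "x \<otimes>\<^bsub>OP X\<^esub> \<one>\<^bsub>OP X\<^esub> = x"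
    using x by (auto simp: OP_def compose_def fun_eq_iff PiE_iff extensional_def)
qed (simp_all add: OP_def orientation_preserving_id orientation_preserving_compose)

end

theory Submission
  imports Defs "HOL-Library.Product_Lexorder"
begin

text \<open>An orientation-preserving map becomes order-preserving after unrolling. Think of the chain
  \<open>X\<close> as bent into a circle; its universal cover is \<open>\<int> \<times> X\<close> with the lexicographic
  order, a bi-infinite row of copies of \<open>X\<close>, and a map \<open>f\<close> is orientation-preserving iff it
  lifts to an order-preserving map \<open>(n, x) \<mapsto> (n + k x, f x)\<close> commuting with the translations
  (\<open>orientation_preserving_iff_cyclic_mono\<close>). Closure under composition is then immediate, and so
  is the fact that every right inverse of a lift, defined on its image, is order-preserving:
  however one chooses preimages, a section of an orientation-preserving map preserves orientation
  (\<open>cyclic_mono_section\<close>).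

  Regularity thereby becomes a question about the subset \<open>B = \<alpha> ` X\<close> alone. If \<open>\<alpha> = \<alpha>\<beta>\<alpha>\<close>, then
  \<open>\<beta>\<alpha>\<close> is an orientation-preserving retraction of \<open>X\<close> onto \<open>B\<close>; conversely, such a retraction
  followed by a section of \<open>\<alpha>\<close> is a suitable \<open>\<beta>\<close> (\<open>regular_iff_cyclic_retraction\<close>). In the cover
  one asks for an order-preserving retraction of \<open>\<int> \<times> X\<close> onto \<open>\<int> \<times> B\<close>. An order-preserving
  retraction has to send a point to its nearest neighbour in \<open>\<int> \<times> B\<close> on one side, so such a
  neighbour must exist; and if it always exists, sending each point to its lower neighbour, or to
  its upper neighbour when there is no lower one, is order-preserving
  (\<open>cyclic_retraction_iff\<close>).

  It remains to read off the condition in \<open>X\<close>. A point \<open>(0, x)\<close> with elements of \<open>B\<close> on both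
  sides of \<open>x\<close> has its neighbours in the same copy, which is the second condition. If \<open>x\<close> is
  an upper or lower bound of \<open>B\<close> outside \<open>B\<close>, then \<open>(0, x)\<close> lies in a gap between two consecutive
  copies of \<open>B\<close>, whose neighbours are the maximum of one copy and the minimum of the next: this is
  the first condition (\<open>cover_gap_iff\<close>).\<close>

section \<open>Orientation-preserving maps as monotone maps of the universal cover\<close>

definition cover_map :: "('a \<Rightarrow> 'b) \<Rightarrow> ('a \<Rightarrow> int) \<Rightarrow> int \<times> 'a \<Rightarrow> int \<times> 'b" where
  "cover_map f k = (\<lambda>(n, x). (n + k x, f x))"

text \<open>Unlike \<^const>\<open>orientation_preserving\<close>, this leaves the codomain free, so that it also applies
  to sections, which are defined on the image only.\<close>

definition cyclic_mono :: "'a::linorder set \<Rightarrow> ('a \<Rightarrow> 'b::linorder) \<Rightarrow> bool" where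
  "cyclic_mono A f \<longleftrightarrow> (\<exists>k. mono_on (UNIV \<times> A) (cover_map f k))"

lemma mono_cover_mapI:
  assumes "\<And>m n x y. x \<in> A \<Longrightarrow> y \<in> A \<Longrightarrow> (m, x) \<le> (n, y) \<Longrightarrow>
    (m + k x, f x) \<le> (n + k y, f y)"
  shows "mono_on (UNIV \<times> A) (cover_map f k)"
  using assms by (auto simp: monotone_on_def cover_map_def simp del: less_eq_prod_simp)

lemma mono_cover_mapD:
  assumes "mono_on (UNIV \<times> A) (cover_map f k)" "x \<in> A" "y \<in> A" "(m, x) \<le> (n, y)"
  shows "(m + k x, f x) \<le> (n + k y, f y)"
  using monotone_onD[OF assms(1), of "(m, x)" "(n, y)"] assms(2-)
  by (simp add: cover_map_def del: less_eq_prod_simp)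

text \<open>The composite of the lifts is a lift of the composite.\<close>

lemma cyclic_mono_compose:
  assumes "cyclic_mono A f" "f ` A \<subseteq> B" "cyclic_mono B g"
  shows "cyclic_mono A (g \<circ> f)"
proof -
  obtain k l where k: "mono_on (UNIV \<times> A) (cover_map f k)"
    and l: "mono_on (UNIV \<times> B) (cover_map g l)"
    using assms(1,3) by (auto simp: cyclic_mono_def)
  have "mono_on (UNIV \<times> A) (cover_map (g \<circ> f) (\<lambda>x. k x + l (f x)))"
  proof (rule mono_cover_mapI)
    fix m n :: int and x y assume xy: "x \<in> A" "y \<in> A" "(m, x) \<le> (n, y)"
    then have "f x \<in> B" "f y \<in> B" using assms(2) by auto
    from mono_cover_mapD[OF l this mono_cover_mapD[OF k xy]]
    show "(m + (k x + l (f x)), (g \<circ> f) x) \<le> (n + (k y + l (f y)), (g \<circ> f) y)"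
      by (simp add: add.assoc del: less_eq_prod_simp)
  qed
  then show ?thesis by (auto simp: cyclic_mono_def)
qed

lemma cyclic_mono_cong:
  assumes "cyclic_mono A f" "\<And>x. x \<in> A \<Longrightarrow> f x = g x"
  shows "cyclic_mono A g"
proof -
  obtain k where k: "mono_on (UNIV \<times> A) (cover_map f k)"
    using assms(1) by (auto simp: cyclic_mono_def)
  have "mono_on (UNIV \<times> A) (cover_map g k)"
    using mono_cover_mapD[OF k] by (intro mono_cover_mapI) (simp add: assms(2)[symmetric])
  then show ?thesis by (auto simp: cyclic_mono_def)
qed

text \<open>The lift that witnesses this moves the part behind the cut up by one copy.\<close>

lemma cyclic_mono_if_cut:
  assumes "Y \<subseteq> A" "mono_on Y f" "mono_on (A - Y) f"
    and cut: "\<And>a b. a \<in> Y \<Longrightarrow> b \<in> A - Y \<Longrightarrow> a \<le> b \<and> f b \<le> f a"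
  shows "cyclic_mono A f"
proof -
  define k where "k x = (if x \<in> Y then 0 else 1 :: int)" for x
  have "(m + k x, f x) \<le> (n + k y, f y)" if "x \<in> A" "y \<in> A" "(m, x) \<le> (n, y)" for m n x y
  proof -
    have 1: "f x \<le> f y" if "x \<le> y" "x \<in> Y \<longleftrightarrow> y \<in> Y"
      using assms(2,3) that \<open>x \<in> A\<close> \<open>y \<in> A\<close> by (auto simp: monotone_on_def)
    show ?thesis
      using 1 cut[of x y] cut[of y x] that by (cases "x = y") (auto simp: k_def)
  qed
  then have "mono_on (UNIV \<times> A) (cover_map f k)"
    by (rule mono_cover_mapI)
  then show ?thesis by (auto simp: cyclic_mono_def)
qed

text \<open>Comparing \<open>(0, x)\<close> with \<open>(1, y)\<close> shows that the level function \<open>k\<close> takes at most two values,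
  and that they are adjacent. The cut is placed between them: \<open>Y\<close> consists of the points of lowest
  level.\<close>

lemma cut_if_cyclic_mono:
  assumes "cyclic_mono A f" "A \<noteq> {}"
  obtains Y where "Y \<noteq> {}" "Y \<subseteq> A" "mono_on Y f" "mono_on (A - Y) f"
    "\<And>a b. a \<in> Y \<Longrightarrow> b \<in> A - Y \<Longrightarrow> a \<le> b \<and> f b \<le> f a"
proof -
  obtain k where k: "mono_on (UNIV \<times> A) (cover_map f k)"
    using assms(1) by (auto simp: cyclic_mono_def)
  note D = mono_cover_mapD[OF k]
  have wrap: "k x < k y + 1 \<or> k x = k y + 1 \<and> f x \<le> f y" if "x \<in> A" "y \<in> A" for x y
    using D[of x y 0 1] that by auto
  have up: "k x < k y \<or> k x = k y \<and> f x \<le> f y" if "x \<in> A" "y \<in> A" "x \<le> y" for x y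
    using D[of x y 0 0] that by auto
  define Y where "Y = {x \<in> A. \<forall>y\<in>A. k x \<le> k y}"
  have "Y \<noteq> {}"
  proof -
    obtain x0 where x0: "x0 \<in> A" using assms(2) by auto
    show ?thesis
    proof (cases "x0 \<in> Y")
      case False
      then obtain y where y: "y \<in> A" "k y < k x0" using x0 by (auto simp: Y_def)
      have "k y \<le> k z" if "z \<in> A" for z
        using wrap[OF x0 that] y by auto
      then show ?thesis using y by (auto simp: Y_def)
    qed auto
  qed
  have same: "k x = k y" if "x \<in> Y" "y \<in> Y" for x y
    using that by (force simp: Y_def)
  have step: "k b = k a + 1" if "a \<in> Y" "b \<in> A - Y" for a b
  proof -
    obtain c where c: "c \<in> A" "k c < k b" using \<open>b \<in> A - Y\<close> by (auto simp: Y_def)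
    have "k a \<le> k c" using that c by (auto simp: Y_def)
    then show ?thesis using wrap[of b a] that c by (auto simp: Y_def)
  qed
  show ?thesis
  proof
    show "Y \<noteq> {}" by fact
    show YA: "Y \<subseteq> A" by (auto simp: Y_def)
    show "mono_on Y f"
    proof (rule mono_onI)
      fix x y assume "x \<in> Y" "y \<in> Y" "x \<le> y"
      then show "f x \<le> f y" using up[of x y] same[of x y] YA by auto
    qed
    obtain a where a: "a \<in> Y" using \<open>Y \<noteq> {}\<close> by auto
    show "mono_on (A - Y) f"
    proof (rule mono_onI)
      fix x y assume "x \<in> A - Y" "y \<in> A - Y" "x \<le> y"
      then show "f x \<le> f y" using up[of x y] step[OF a, of x] step[OF a, of y] by auto
    qed
    fix a b assume ab: "a \<in> Y" "b \<in> A - Y"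
    then show "a \<le> b \<and> f b \<le> f a"
      using step[OF ab] wrap[of b a] up[of b a] subsetD[OF YA ab(1)] linear[of a b] by auto
  qed
qed

lemma orientation_preserving_iff_cyclic_mono:
  "orientation_preserving X \<alpha> \<longleftrightarrow> \<alpha> \<in> X \<rightarrow>\<^sub>E X \<and> cyclic_mono X \<alpha>"
proof (cases "X = {}")
  case True
  then show ?thesis
    by (auto simp: orientation_preserving_def cyclic_mono_def monotone_on_def)
next
  case False
  show ?thesis
  proof
    assume "orientation_preserving X \<alpha>"
    then show "\<alpha> \<in> X \<rightarrow>\<^sub>E X \<and> cyclic_mono X \<alpha>"
      using False cyclic_mono_if_cut[of _ X \<alpha>] unfolding orientation_preserving_def by blast
  next
    assume *: "\<alpha> \<in> X \<rightarrow>\<^sub>E X \<and> cyclic_mono X \<alpha>"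
    then obtain Y where "Y \<noteq> {}" "Y \<subseteq> X" "mono_on Y \<alpha>" "mono_on (X - Y) \<alpha>"
      "\<And>a b. a \<in> Y \<Longrightarrow> b \<in> X - Y \<Longrightarrow> a \<le> b \<and> \<alpha> b \<le> \<alpha> a"
      using cut_if_cyclic_mono[of X \<alpha>] False by blast
    with * show "orientation_preserving X \<alpha>"
      unfolding orientation_preserving_def by blast
  qed
qed

text \<open>A monotone map reflects the strict order of a linearly ordered domain. The point
  \<open>(- k (s t), s t)\<close> is a preimage of \<open>(0, t)\<close> under the lift of \<open>f\<close>, and translating it gives a
  lift of \<open>s\<close>.\<close>

lemma cyclic_mono_section:
  assumes "cyclic_mono A f" "s ` B \<subseteq> A" "\<And>t. t \<in> B \<Longrightarrow> f (s t) = t"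
  shows "cyclic_mono B s"
proof -
  obtain k where k: "mono_on (UNIV \<times> A) (cover_map f k)"
    using assms(1) by (auto simp: cyclic_mono_def)
  have "(m - k (s t), s t) \<le> (n - k (s u), s u)"
    if tu: "t \<in> B" "u \<in> B" "(m, t) \<le> (n, u)" for m n t u
  proof (rule ccontr)
    assume neg: "\<not> ?thesis"
    then have "(n - k (s u), s u) \<le> (m - k (s t), s t)" by (meson linear)
    from mono_cover_mapD[OF k _ _ this] have "(n, u) \<le> (m, t)"
      using assms(2,3) tu by auto
    then have "n = m \<and> u = t" using tu(3) by (metis antisym prod.inject)
    then show False using neg by auto
  qed
  then have "mono_on (UNIV \<times> B) (cover_map s (\<lambda>t. - k (s t)))"
    by (intro mono_cover_mapI) simp
  then show ?thesis by (auto simp: cyclic_mono_def)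
qed

section \<open>Retractions onto a subset\<close>

text \<open>Preferring the lower neighbour makes all points of one gap of \<open>S\<close> agree on the side they
  choose, which is what monotonicity needs; an arbitrary choice of sides would not be monotone.\<close>

definition nearest :: "'b::linorder set \<Rightarrow> 'b \<Rightarrow> 'b \<Rightarrow> bool" where
  "nearest S z p \<longleftrightarrow> p \<in> S \<and>
     (if has_max {s \<in> S. s \<le> z} then p \<le> z \<and> (\<forall>s\<in>S. s \<le> z \<longrightarrow> s \<le> p)
      else z \<le> p \<and> (\<forall>s\<in>S. z \<le> s \<longrightarrow> p \<le> s))"

lemma nearest_exists:
  assumes "has_max {s \<in> S. s \<le> z} \<or> has_min {s \<in> S. z \<le> s}"
  shows "\<exists>p. nearest S z p"
proof (cases "has_max {s \<in> S. s \<le> z}")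
  case True
  then obtain p where "p \<in> {s \<in> S. s \<le> z}" "\<forall>t\<in>{s \<in> S. s \<le> z}. t \<le> p"
    unfolding has_max_def by blast
  then show ?thesis using True by (auto simp: nearest_def)
next
  case False
  then obtain p where "p \<in> {s \<in> S. z \<le> s}" "\<forall>t\<in>{s \<in> S. z \<le> s}. p \<le> t"
    using assms unfolding has_min_def by blast
  then show ?thesis using False by (auto simp: nearest_def)
qed

text \<open>If \<open>q < p\<close>, then \<open>z\<close> must have moved up and \<open>w\<close> down, so both lie in the gap between \<open>q\<close> and
  \<open>p\<close>. But then \<open>q\<close> is also a lower neighbour of \<open>z\<close>, which \<open>z\<close> should have preferred.\<close>

lemma nearest_mono:
  assumes "nearest S z p" "nearest S w q" "z \<le> w"
  shows "p \<le> q"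
proof (rule ccontr)
  assume "\<not> p \<le> q"
  then have "q < p" by simp
  have S: "p \<in> S" "q \<in> S" using assms by (auto simp: nearest_def)
  have no_max: "\<not> has_max {s \<in> S. s \<le> z}"
  proof
    assume "has_max {s \<in> S. s \<le> z}"
    then have "p \<le> w" using assms(1,3) by (auto simp: nearest_def)
    then have "p \<le> q" using assms(2) S by (auto simp: nearest_def split: if_splits)
    then show False using \<open>q < p\<close> by simp
  qed
  then have least: "z \<le> p" "\<And>s. s \<in> S \<Longrightarrow> z \<le> s \<Longrightarrow> p \<le> s"
    using assms(1) by (auto simp: nearest_def)
  have "q < z" using least(2)[OF S(2)] \<open>q < p\<close> by force
  then have "s \<le> q" if "s \<in> S" "s \<le> z" for s
    using assms(2,3) that by (auto simp: nearest_def split: if_splits)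
  then have "has_max {s \<in> S. s \<le> z}"
    using S(2) \<open>q < z\<close> by (auto simp: has_max_def)
  then show False using no_max by simp
qed

lemma has_max_shift:
  fixes m n :: int
  shows "has_max {q \<in> UNIV \<times> B. q \<le> (m, x)} \<longleftrightarrow> has_max {q \<in> UNIV \<times> B. q \<le> (n, x)}"
proof -
  have shift: "has_max {q \<in> UNIV \<times> B. q \<le> (d, x)}"
    if P: "has_max {q \<in> UNIV \<times> B. q \<le> (c, x)}" for c d :: int
  proof -
    from P obtain j t where j: "t \<in> B" "(j, t) \<le> (c, x)"
      "\<And>i s. s \<in> B \<Longrightarrow> (i, s) \<le> (c, x) \<Longrightarrow> (i, s) \<le> (j, t)"
      by (auto simp: has_max_def simp del: less_eq_prod_simp)
    have "(i, s) \<le> (j + d - c, t)" if "s \<in> B" "(i, s) \<le> (d, x)" for i s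
      using j(3)[of s "i - d + c"] that by auto
    moreover have "(j + d - c, t) \<le> (d, x)" using j(2) by auto
    ultimately show ?thesis using j(1)
      unfolding has_max_def by (intro bexI[of _ "(j + d - c, t)"]) auto
  qed
  show ?thesis using shift by blast
qed

text \<open>Translations are order automorphisms of \<open>\<int> \<times> B\<close>, so neighbours need to be chosen in one
  copy only, and the resulting map is a lift.\<close>

lemma nearest_shift:
  assumes "nearest (UNIV \<times> B) (0 :: int, x) (j, t)"
  shows "nearest (UNIV \<times> B) (n, x) (n + j, t)"
proof -
  have le: "(i, s) \<le> (n + j, t) \<longleftrightarrow> (i - n, s) \<le> (j, t)"
    "(n + j, t) \<le> (i, s) \<longleftrightarrow> (j, t) \<le> (i - n, s)"
    "(i, s) \<le> (n, x) \<longleftrightarrow> (i - n, s) \<le> (0, x)"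
    "(n, x) \<le> (i, s) \<longleftrightarrow> (0, x) \<le> (i - n, s)" for i s
    by auto
  show ?thesis
    using assms unfolding nearest_def has_max_shift[of B n x 0]
    by (auto simp: le split: if_splits simp del: less_eq_prod_simp)
qed

text \<open>Forwards, a lift \<open>R\<close> of a retraction has constant level on \<open>B\<close> and can be translated so as to
  fix \<open>\<int> \<times> B\<close> pointwise. If \<open>q \<in> \<int> \<times> B\<close> lies below \<open>z\<close>, then \<open>q = R q \<le> R z\<close>, and dually above
  \<open>z\<close>; hence \<open>R z\<close> is the neighbour of \<open>z\<close> on the side on which it lies.\<close>

lemma cyclic_retraction_iff:
  assumes "B \<subseteq> A"
  shows "(\<exists>r. r ` A \<subseteq> B \<and> (\<forall>t\<in>B. r t = t) \<and> cyclic_mono A r) \<longleftrightarrow>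
    (\<forall>x\<in>A. has_max {q \<in> UNIV \<times> B. q \<le> (0 :: int, x)} \<or>
           has_min {q \<in> UNIV \<times> B. (0 :: int, x) \<le> q})"
    (is "?L \<longleftrightarrow> ?R")
proof
  assume ?L
  then obtain r k where r: "r ` A \<subseteq> B" "\<And>t. t \<in> B \<Longrightarrow> r t = t"
    and k: "mono_on (UNIV \<times> A) (cover_map r k)"
    by (auto simp: cyclic_mono_def)
  note D = mono_cover_mapD[OF k]
  have const_le: "k s = k t" if "s \<in> B" "t \<in> B" "s < t" for s t
    using D[of s t 0 0] D[of t s 0 1] that less_imp_le[OF that(3)]
      subsetD[OF assms that(1)] subsetD[OF assms that(2)] r(2) by auto
  then have const: "k s = k t" if "s \<in> B" "t \<in> B" for s t
    using that by (metis linorder_cases)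
  show ?R
  proof
    fix x assume x: "x \<in> A"
    define t where "t = r x"
    \<comment> \<open>Subtracting the constant level on \<open>B\<close> is the translation that makes the lift fix \<open>B\<close>.\<close>
    define j where "j = k x - k t"
    have t: "t \<in> B" using r(1) x by (auto simp: t_def)
    have below: "(i, s) \<le> (j, t)" if "s \<in> B" "(i, s) \<le> (0 :: int, x)" for i s
      using D[OF _ x that(2)] that(1) assms r(2) const[OF that(1) t]
      by (auto simp: j_def t_def)
    have above: "(j, t) \<le> (i, s)" if "s \<in> B" "(0 :: int, x) \<le> (i, s)" for i s
      using D[OF x _ that(2)] that(1) assms r(2) const[OF that(1) t]
      by (auto simp: j_def t_def)
    show "has_max {q \<in> UNIV \<times> B. q \<le> (0 :: int, x)} \<or> has_min {q \<in> UNIV \<times> B. (0 :: int, x) \<le> q}"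
    proof (cases "(j, t) \<le> (0 :: int, x)")
      case True
      then have "has_max {q \<in> UNIV \<times> B. q \<le> (0 :: int, x)}"
        unfolding has_max_def using t below by (intro bexI[of _ "(j, t)"]) auto
      then show ?thesis ..
    next
      case False
      then have "(0 :: int, x) \<le> (j, t)" by (meson linear)
      then have "has_min {q \<in> UNIV \<times> B. (0 :: int, x) \<le> q}"
        unfolding has_min_def using t above by (intro bexI[of _ "(j, t)"]) auto
      then show ?thesis ..
    qed
  qed
next
  assume ?R
  then have "\<forall>x\<in>A. \<exists>p. nearest (UNIV \<times> B) (0 :: int, x) p"
    using nearest_exists by blast
  then obtain p where p: "\<And>x. x \<in> A \<Longrightarrow> nearest (UNIV \<times> B) (0 :: int, x) (p x)"
    by metis
  define k r where "k x = fst (p x)" and "r x = snd (p x)" for x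
  have near: "nearest (UNIV \<times> B) (n, x) (n + k x, r x)" if "x \<in> A" for n x
    using nearest_shift[of B x "k x" "r x" n] p[OF that] by (simp add: k_def r_def)
  have "mono_on (UNIV \<times> A) (cover_map r k)"
    by (rule mono_cover_mapI) (rule nearest_mono[OF near near])
  moreover have "r ` A \<subseteq> B"
    using near by (auto simp: nearest_def)
  moreover have "r t = t" if "t \<in> B" for t
  proof -
    have "nearest (UNIV \<times> B) (0 :: int, t) (0, t)"
      using that unfolding nearest_def has_max_def by force
    then have "(0, t) = (0 + k t, r t)"
      using near[of t 0] that assms by (metis nearest_mono antisym order_refl subsetD)
    then show ?thesis by simp
  qed
  ultimately show ?L by (auto simp: cyclic_mono_def)
qed

section \<open>Neighbours in the cover and in the chain\<close>

text \<open>If nothing of \<open>B\<close> lies below \<open>x\<close>, the part of \<open>\<int> \<times> B\<close> below \<open>(0, x)\<close> ends with the entire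
  copy \<open>{-1} \<times> B\<close>.\<close>

lemma has_max_cover_below:
  "has_max {q \<in> UNIV \<times> B. q \<le> (0 :: int, x)} \<longleftrightarrow>
    has_max {t \<in> B. t \<le> x} \<or> {t \<in> B. t \<le> x} = {} \<and> has_max B" (is "?L \<longleftrightarrow> ?R")
proof
  assume ?L
  then obtain j t where j: "t \<in> B" "(j, t) \<le> (0 :: int, x)"
    "\<And>i s. s \<in> B \<Longrightarrow> (i, s) \<le> (0, x) \<Longrightarrow> (i, s) \<le> (j, t)"
    by (auto simp: has_max_def simp del: less_eq_prod_simp)
  show ?R
  proof (cases "{t \<in> B. t \<le> x} = {}")
    case True
    have "s \<le> t" if "s \<in> B" for s
      using j(1,2) j(3)[of s "-1"] that True by auto
    then have "has_max B" using j(1) unfolding has_max_def by blast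
    then show ?thesis using True by blast
  next
    case False
    then obtain s where "s \<in> B" "s \<le> x" by auto
    then have "j = 0" using j(2) j(3)[of s 0] by auto
    moreover have "s \<le> t" if "s \<in> B" "s \<le> x" for s
      using j(3)[of s 0] that \<open>j = 0\<close> by auto
    ultimately show ?thesis using j(1,2) by (auto simp: has_max_def)
  qed
next
  assume ?R
  then consider m where "m \<in> B" "m \<le> x" "\<forall>t\<in>B. t \<le> x \<longrightarrow> t \<le> m"
    | m where "{t \<in> B. t \<le> x} = {}" "m \<in> B" "\<forall>t\<in>B. t \<le> m"
    by (auto simp: has_max_def)
  then show ?L
  proof cases
    case (1 m)
    then show ?thesis unfolding has_max_def by (intro bexI[of _ "(0, m)"]) auto
  next
    case (2 m)
    then show ?thesis unfolding has_max_def by (intro bexI[of _ "(-1, m)"]) auto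
  qed
qed

lemma has_min_cover_above:
  "has_min {q \<in> UNIV \<times> B. (0 :: int, x) \<le> q} \<longleftrightarrow>
    has_min {t \<in> B. x \<le> t} \<or> {t \<in> B. x \<le> t} = {} \<and> has_min B" (is "?L \<longleftrightarrow> ?R")
proof
  assume ?L
  then obtain j t where j: "t \<in> B" "(0 :: int, x) \<le> (j, t)"
    "\<And>i s. s \<in> B \<Longrightarrow> (0, x) \<le> (i, s) \<Longrightarrow> (j, t) \<le> (i, s)"
    by (auto simp: has_min_def simp del: less_eq_prod_simp)
  show ?R
  proof (cases "{t \<in> B. x \<le> t} = {}")
    case True
    have "t \<le> s" if "s \<in> B" for s
      using j(1,2) j(3)[of s 1] that True by auto
    then have "has_min B" using j(1) unfolding has_min_def by blast
    then show ?thesis using True by blast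
  next
    case False
    then obtain s where "s \<in> B" "x \<le> s" by auto
    then have "j = 0" using j(2) j(3)[of s 0] by auto
    moreover have "t \<le> s" if "s \<in> B" "x \<le> s" for s
      using j(3)[of s 0] that \<open>j = 0\<close> by auto
    ultimately show ?thesis using j(1,2) by (auto simp: has_min_def)
  qed
next
  assume ?R
  then consider m where "m \<in> B" "x \<le> m" "\<forall>t\<in>B. x \<le> t \<longrightarrow> m \<le> t"
    | m where "{t \<in> B. x \<le> t} = {}" "m \<in> B" "\<forall>t\<in>B. m \<le> t"
    by (auto simp: has_min_def)
  then show ?L
  proof cases
    case (1 m)
    then show ?thesis unfolding has_min_def by (intro bexI[of _ "(0, m)"]) auto
  next
    case (2 m)
    then show ?thesis unfolding has_min_def by (intro bexI[of _ "(1, m)"]) auto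
  qed
qed

text \<open>Points of \<open>B\<close> are their own neighbours. For a bound of \<open>B\<close> outside \<open>B\<close> the neighbours lie at
  the ends of two consecutive copies of \<open>B\<close>, and for the other points within one copy. A bound that
  belongs to \<open>B\<close> is a maximum or minimum of \<open>B\<close>, so the first condition holds by itself then.\<close>

lemma cover_gap_iff:
  fixes B X :: "'a::linorder set"
  assumes "B \<subseteq> X" "B \<noteq> {}"
  shows "(\<forall>x\<in>X. has_max {q \<in> UNIV \<times> B. q \<le> (0 :: int, x)} \<or>
           has_min {q \<in> UNIV \<times> B. (0 :: int, x) \<le> q}) \<longleftrightarrow>
    ((\<exists>u\<in>X. upper_bound B u) \<or> (\<exists>l\<in>X. lower_bound B l) \<longrightarrow> has_max B \<or> has_min B) \<and>
    (\<forall>x\<in>X - B. \<not> upper_bound B x \<and> \<not> lower_bound B x \<longrightarrow>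
       has_max {t \<in> B. t < x} \<or> has_min {t \<in> B. t > x})"
proof -
  define G where "G x \<longleftrightarrow> has_max {q \<in> UNIV \<times> B. q \<le> (0 :: int, x)} \<or>
           has_min {q \<in> UNIV \<times> B. (0 :: int, x) \<le> q}" for x
  have G_iff: "G x \<longleftrightarrow> has_max {t \<in> B. t \<le> x} \<or> {t \<in> B. t \<le> x} = {} \<and> has_max B \<or>
      has_min {t \<in> B. x \<le> t} \<or> {t \<in> B. x \<le> t} = {} \<and> has_min B" for x
    by (auto simp: G_def has_max_cover_below has_min_cover_above)
  have mem: "G x" if "x \<in> B" for x
    using that unfolding G_iff by (auto simp: has_max_def)
  have bound: "G x \<longleftrightarrow> has_max B \<or> has_min B"
    if "x \<notin> B" "upper_bound B x \<or> lower_bound B x" for x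
  proof -
    have "\<not> has_max ({} :: 'a set)" "\<not> has_min ({} :: 'a set)"
      by (auto simp: has_max_def has_min_def)
    moreover have "{t \<in> B. t \<le> x} = B \<and> {t \<in> B. x \<le> t} = {} \<or>
        {t \<in> B. t \<le> x} = {} \<and> {t \<in> B. x \<le> t} = B"
      using that by (force simp: upper_bound_def lower_bound_def)
    ultimately show ?thesis
      using assms(2) unfolding G_iff by metis
  qed
  have bound_mem: "has_max B \<or> has_min B"
    if "x \<in> B" "upper_bound B x \<or> lower_bound B x" for x
    using that by (auto simp: upper_bound_def lower_bound_def has_max_def has_min_def)
  have gap: "G x \<longleftrightarrow> has_max {t \<in> B. t < x} \<or> has_min {t \<in> B. t > x}"
    if "x \<notin> B" "\<not> upper_bound B x" "\<not> lower_bound B x" for x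
  proof -
    have "{t \<in> B. t \<le> x} = {t \<in> B. t < x}" "{t \<in> B. x \<le> t} = {t \<in> B. t > x}"
      using that(1) by (force simp: order.order_iff_strict)+
    moreover have "{t \<in> B. t < x} \<noteq> {}" "{t \<in> B. t > x} \<noteq> {}"
      using that by (auto simp: upper_bound_def lower_bound_def not_le)
    ultimately show ?thesis unfolding G_iff by auto
  qed
  show ?thesis
    unfolding G_def[symmetric] using mem bound bound_mem gap by blast
qed

section \<open>Regular elements\<close>

text \<open>With maps written on the right, the retraction is \<open>\<beta>\<alpha>\<close>; conversely \<open>\<beta>\<close> is the retraction
  \<open>r\<close> followed by a section \<open>s\<close> of \<open>\<alpha>\<close>.\<close>

lemma regular_iff_cyclic_retraction:
  assumes "\<alpha> \<in> carrier (OP X)"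
  shows "regular_element (OP X) \<alpha> \<longleftrightarrow>
    (\<exists>r. r ` X \<subseteq> \<alpha> ` X \<and> (\<forall>t\<in>\<alpha> ` X. r t = t) \<and> cyclic_mono X r)"
    (is "_ \<longleftrightarrow> ?R")
proof
  have \<alpha>: "\<alpha> \<in> X \<rightarrow>\<^sub>E X" "cyclic_mono X \<alpha>"
    using assms by (auto simp: OP_def orientation_preserving_iff_cyclic_mono)
  {
    assume "regular_element (OP X) \<alpha>"
    then obtain \<beta> where \<beta>: "orientation_preserving X \<beta>"
      and eq: "\<alpha> = compose X \<alpha> (compose X \<beta> \<alpha>)"
      by (auto simp: regular_element_def OP_def)
    have b: "\<beta> \<in> X \<rightarrow>\<^sub>E X" "cyclic_mono X \<beta>"
      using \<beta> by (auto simp: orientation_preserving_iff_cyclic_mono)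
    have "(\<alpha> \<circ> \<beta>) (\<alpha> x) = \<alpha> x" if "x \<in> X" for x
      using fun_cong[OF eq, of x] that \<alpha>(1) by (auto simp: compose_def)
    moreover have "cyclic_mono X (\<alpha> \<circ> \<beta>)"
      using cyclic_mono_compose[OF b(2) _ \<alpha>(2)] b(1) by auto
    moreover have "(\<alpha> \<circ> \<beta>) ` X \<subseteq> \<alpha> ` X" using b(1) by auto
    ultimately show ?R by blast
  next
    assume ?R
    then obtain r where r: "r ` X \<subseteq> \<alpha> ` X" "\<And>t. t \<in> \<alpha> ` X \<Longrightarrow> r t = t" "cyclic_mono X r"
      by blast
    define s where "s = inv_into X \<alpha>"
    have s: "s ` \<alpha> ` X \<subseteq> X" "\<And>t. t \<in> \<alpha> ` X \<Longrightarrow> \<alpha> (s t) = t"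
      by (auto simp: s_def inv_into_into f_inv_into_f)
    define \<beta> where "\<beta> = restrict (s \<circ> r) X"
    have "cyclic_mono X (s \<circ> r)"
      using cyclic_mono_compose[OF r(3,1)] cyclic_mono_section[OF \<alpha>(2) s] by blast
    then have "cyclic_mono X \<beta>"
      by (rule cyclic_mono_cong) (simp add: \<beta>_def)
    moreover have "\<beta> \<in> X \<rightarrow>\<^sub>E X"
      using r(1) s(1) by (force simp: \<beta>_def)
    ultimately have "orientation_preserving X \<beta>"
      by (simp add: orientation_preserving_iff_cyclic_mono)
    moreover have "\<alpha> = compose X \<alpha> (compose X \<beta> \<alpha>)"
    proof
      fix x
      show "\<alpha> x = compose X \<alpha> (compose X \<beta> \<alpha>) x"
      proof (cases "x \<in> X")
        case True
        moreover have "\<alpha> x \<in> X" using True \<alpha>(1) by auto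
        ultimately show ?thesis using r(2) s(2) by (simp add: compose_def \<beta>_def)
      next
        case False
        then show ?thesis using \<alpha>(1) by (auto simp: compose_def PiE_def extensional_def)
      qed
    qed
    ultimately show "regular_element (OP X) \<alpha>"
      using assms by (auto simp: regular_element_def OP_def)
  }
qed

theorem theorem2p6:
  fixes X :: "'a::linorder set" and \<alpha> :: "'a \<Rightarrow> 'a"
  assumes "\<alpha> \<in> carrier (OP X)"
  shows "regular_element (OP X) \<alpha> \<longleftrightarrow>
    ((\<exists>u\<in>X. upper_bound (\<alpha> ` X) u) \<or> (\<exists>l\<in>X. lower_bound (\<alpha> ` X) l) \<longrightarrow>
       has_max (\<alpha> ` X) \<or> has_min (\<alpha> ` X)) \<and>
    (\<forall>x\<in>X - \<alpha> ` X. \<not> upper_bound (\<alpha> ` X) x \<and> \<not> lower_bound (\<alpha> ` X) x \<longrightarrow>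
       has_max {t \<in> \<alpha> ` X. t < x} \<or> has_min {t \<in> \<alpha> ` X. t > x})"
proof -
  have sub: "\<alpha> ` X \<subseteq> X"
    using assms by (auto simp: OP_def orientation_preserving_def)
  show ?thesis
  proof (cases "X = {}")
    \<comment> \<open>Here \<open>cover_gap_iff\<close> does not apply, but all the conditions are vacuous.\<close>
    case True
    then show ?thesis
      using regular_iff_cyclic_retraction[OF assms] cyclic_retraction_iff[OF sub] by simp
  next
    case False
    then show ?thesis
      unfolding regular_iff_cyclic_retraction[OF assms] cyclic_retraction_iff[OF sub]
      using cover_gap_iff[OF sub] by simp
  qed
qed

end
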